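(* Let $\mathbb{F}$ be a field and let the variables $\mathbf{x} = \mathbf{x}_1 \sqcup \cdots \sqcup \mathbf{x}_d$ be partitioned into $d$ parts with $|\mathbf{x}_i| = n$ for all $i \in [d]$. Let $f(\mathbf{x})$ be a set-multilinear polynomial with respect to this partition that is computed by a homogeneous formula $\Phi$ (not necessarily set-multilinear) of size $s = n^c$. If $d$ is sub-polynomial in $n$, that is, $\log d = o(\log n)$, then \[ \operatorname{TensorRank}(f) \leq \frac{n^d}{n^{d/\exp(c)}}. \]
   Context: A polynomial $f(\mathbf{x})$ is set-multilinear with respect to the partition $\mathbf{x} = \mathbf{x}_1 \sqcup \cdots \sqcup \mathbf{x}_d$ if every monomial of $f$ contains exactly one variable from each part $\mathbf{x}_i$. The tensor rank $\operatorname{TensorRank}(f)$ of such an $f$ is the smallest $r$ such that $f = \sum_{i=1}^r \ell_{i1}(\mathbf{x}_1)\cdots \ell_{id}(\mathbf{x}_d)$, where each $\ell_{ij}(\mathbf{x}_j)$ is a linear form in the variables of $\mathbf{x}_j$. A homogeneous formula is one in which every gate computes a homogeneous polynomial. Here $\exp(c)$ denotes a quantity of the form $2^{O(c)}$ depending only on $c$ (not on $n$ or $d$), and the bound holds for all sufficiently large $n$. *)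

theory Defs
  imports Complex_Main "HOL-Library.Poly_Mapping" "HOL-Library.Landau_Symbols"
begin

text \<open>Formal multivariate polynomials: finitely supported maps from monomials (exponent vectors)
  to coefficients, with the convolution product of \<^theory>\<open>HOL-Library.Poly_Mapping\<close>.\<close>

type_synonym 'v monomial = "'v \<Rightarrow>\<^sub>0 nat"
type_synonym ('v, 'a) mpoly = "'v monomial \<Rightarrow>\<^sub>0 'a"

definition mvar :: "'v \<Rightarrow> ('v, 'a::comm_ring_1) mpoly" where
  "mvar v = Poly_Mapping.single (Poly_Mapping.single v 1) 1"

definition mconst :: "'a \<Rightarrow> ('v, 'a::comm_ring_1) mpoly" where
  "mconst a = Poly_Mapping.single 0 a"

definition mdegree :: "'v monomial \<Rightarrow> nat" where
  "mdegree m = (\<Sum>v\<in>Poly_Mapping.keys m. Poly_Mapping.lookup m v)"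

text \<open>The zero polynomial is homogeneous (of every degree).\<close>

definition homogeneous :: "('v, 'a::comm_ring_1) mpoly \<Rightarrow> bool" where
  "homogeneous p \<longleftrightarrow> (\<exists>k. \<forall>m\<in>Poly_Mapping.keys p. mdegree m = k)"

text \<open>Arithmetic formulas with gates of unbounded fan-in; the leaves are variables or field
  constants, and the size is the number of nodes, leaves included.\<close>

datatype (formula_vars: 'v, 'a) formula =
    Var 'v
  | Const 'a
  | Add "('v, 'a) formula list"
  | Mult "('v, 'a) formula list"

fun formula_poly :: "('v, 'a::comm_ring_1) formula \<Rightarrow> ('v, 'a) mpoly" where
  "formula_poly (Var v) = mvar v"
| "formula_poly (Const a) = mconst a"
| "formula_poly (Add Fs) = sum_list (map formula_poly Fs)"
| "formula_poly (Mult Fs) = prod_list (map formula_poly Fs)"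

fun formula_size :: "('v, 'a) formula \<Rightarrow> nat" where
  "formula_size (Var v) = 1"
| "formula_size (Const a) = 1"
| "formula_size (Add Fs) = 1 + sum_list (map formula_size Fs)"
| "formula_size (Mult Fs) = 1 + sum_list (map formula_size Fs)"

fun homogeneous_formula :: "('v, 'a::comm_ring_1) formula \<Rightarrow> bool" where
  "homogeneous_formula (Var v) \<longleftrightarrow> homogeneous (formula_poly (Var v) :: ('v, 'a) mpoly)"
| "homogeneous_formula (Const a) \<longleftrightarrow> homogeneous (formula_poly (Const a) :: ('v, 'a) mpoly)"
| "homogeneous_formula (Add Fs) \<longleftrightarrow>
     homogeneous (formula_poly (Add Fs)) \<and> (\<forall>F\<in>set Fs. homogeneous_formula F)"
| "homogeneous_formula (Mult Fs) \<longleftrightarrow>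
     homogeneous (formula_poly (Mult Fs)) \<and> (\<forall>F\<in>set Fs. homogeneous_formula F)"

text \<open>The variables are indexed by pairs: for \<open>i < d\<close>, the \<open>i\<close>-th part of the partition
  consists of the \<open>n\<close> variables \<open>(i, 0), \<dots>, (i, n - 1)\<close>.\<close>

definition partition_vars :: "nat \<Rightarrow> nat \<Rightarrow> (nat \<times> nat) set" where
  "partition_vars n d = {..<d} \<times> {..<n}"

text \<open>Variables in a monomial are counted with multiplicity, so that the one variable from
  each part occurs with exponent 1.\<close>

definition set_multilinear :: "nat \<Rightarrow> nat \<Rightarrow> (nat \<times> nat, 'a::comm_ring_1) mpoly \<Rightarrow> bool" where
  "set_multilinear n d f \<longleftrightarrow>
     (\<forall>m\<in>Poly_Mapping.keys f. Poly_Mapping.keys m \<subseteq> partition_vars n d \<and>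
        (\<forall>i<d. (\<Sum>j<n. Poly_Mapping.lookup m (i, j)) = 1))"

definition linear_form_in_part :: "nat \<Rightarrow> nat \<Rightarrow> (nat \<times> nat, 'a::comm_ring_1) mpoly \<Rightarrow> bool" where
  "linear_form_in_part n i l \<longleftrightarrow> (\<exists>a. l = (\<Sum>j<n. mconst (a j) * mvar (i, j)))"

text \<open>For \<open>d \<ge> 1\<close> every set-multilinear \<open>f\<close> has such a decomposition (expand it into
  monomials), so the minimum is attained.\<close>

definition tensor_rank :: "nat \<Rightarrow> nat \<Rightarrow> (nat \<times> nat, 'a::comm_ring_1) mpoly \<Rightarrow> nat" where
  "tensor_rank n d f =
     (LEAST r. \<exists>l. (\<forall>k<r. \<forall>i<d. linear_form_in_part n i (l k i)) \<and>
                   f = (\<Sum>k<r. \<Prod>i<d. l k i))"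

end

theory Submission
  imports Defs "HOL-Library.FuncSet"
begin

text \<open>For \<open>S\<close> a set of parts, let \<open>F\<^sub>S\<close> be the sum of those monomials of the polynomial of \<open>F\<close> that
  contain exactly one variable of each part in \<open>S\<close> and no others. Any such polynomial has rank at most
  \<open>n ^ (|S| - 1)\<close>, and \<open>(F G)\<^sub>S\<close> is the sum of the products \<open>F\<^sub>A G\<^bsub>S - A\<^esub>\<close>, where homogeneity of \<open>F\<close> fixes
  the cardinality of \<open>A\<close>. By induction on a formula of size at most \<open>n powr c\<close>, the rank of \<open>F\<^sub>S\<close> is at most
  \<open>|F| |S|! n powr (|S| - \<phi> |S|)\<close> for the saving \<open>\<phi> = saving c\<close>. At a product of parts of degrees \<open>a \<ge> b\<close> one
  uses the inductive bound for the factor of larger degree and, for the other factor, either the trivial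
  bound, which saves 1, or the inductive bound, whose extra factor \<open>|G| \<le> n powr c\<close> costs \<open>c\<close>.
  The function \<open>\<phi>\<close> grows logarithmically up to the threshold \<open>2 powr c\<close>, where it has
  accumulated the \<open>c\<close> needed to pay for the second option, and linearly from there on. Finally,
  \<open>|S|! \<le> d ^ d\<close> is absorbed because \<open>d\<close> is sub-polynomial in \<open>n\<close>.\<close>

section \<open>Set-multilinear monomials and components\<close>

definition sm_monomial :: "nat set \<Rightarrow> (nat \<Rightarrow> nat) \<Rightarrow> (nat \<times> nat) monomial" where
  "sm_monomial S g = (\<Sum>i\<in>S. Poly_Mapping.single (i, g i) 1)"

text \<open>The sum runs over extensional functions because \<open>sm_monomial\<close> sees a choice
  only on \<open>S\<close>; thus each monomial is listed exactly once.\<close>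

definition sm_component ::
  "nat \<Rightarrow> nat set \<Rightarrow> (nat \<times> nat, 'a::comm_ring_1) mpoly \<Rightarrow> (nat \<times> nat, 'a) mpoly" where
  "sm_component n S p =
     (\<Sum>g\<in>S \<rightarrow>\<^sub>E {..<n}. Poly_Mapping.single (sm_monomial S g) (Poly_Mapping.lookup p (sm_monomial S g)))"

lemma lookup_sm_monomial:
  assumes "finite S"
  shows "Poly_Mapping.lookup (sm_monomial S g) (i, j) = (if i \<in> S \<and> j = g i then 1 else 0)"
proof -
  have "Poly_Mapping.lookup (sm_monomial S g) (i, j) = (\<Sum>k\<in>S. if k = i then (if j = g i then 1 else 0) else 0)"
    unfolding sm_monomial_def lookup_sum
    by (intro sum.cong) (auto simp: lookup_single when_def)
  then show ?thesis using assms by simp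
qed

lemma sm_monomial_cong: "(\<And>i. i \<in> S \<Longrightarrow> g i = h i) \<Longrightarrow> sm_monomial S g = sm_monomial S h"
  by (simp add: sm_monomial_def)

lemma sm_monomial_inj:
  assumes "finite S" "g \<in> S \<rightarrow>\<^sub>E T" "h \<in> S \<rightarrow>\<^sub>E T" "sm_monomial S g = sm_monomial S h"
  shows "g = h"
proof (rule PiE_ext[OF assms(2,3)])
  fix i assume "i \<in> S"
  then have "Poly_Mapping.lookup (sm_monomial S h) (i, g i) = 1"
    using assms(1,4) lookup_sm_monomial[of S g i "g i"] by simp
  then show "g i = h i"
    using assms(1) by (simp add: lookup_sm_monomial split: if_splits)
qed

lemma mdegree_sm_monomial:
  assumes "finite S" shows "mdegree (sm_monomial S g) = card S"
proof -
  have "Poly_Mapping.keys (sm_monomial S g) = (\<lambda>i. (i, g i)) ` S"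
    using assms by (auto simp: in_keys_iff lookup_sm_monomial split: if_splits)
  moreover have "inj_on (\<lambda>i. (i, g i)) S" by (auto simp: inj_on_def)
  ultimately show ?thesis
    using assms by (simp add: mdegree_def sum.reindex lookup_sm_monomial)
qed

lemma lookup_sm_component:
  assumes "finite S"
  shows "Poly_Mapping.lookup (sm_component n S p) m =
    (if m \<in> sm_monomial S ` (S \<rightarrow>\<^sub>E {..<n}) then Poly_Mapping.lookup p m else 0)"
proof -
  let ?F = "S \<rightarrow>\<^sub>E {..<n}"
  have fin: "finite ?F" using assms by (simp add: finite_PiE)
  have inj: "inj_on (sm_monomial S) ?F"
    using sm_monomial_inj[OF assms] by (auto simp: inj_on_def)
  have "Poly_Mapping.lookup (sm_component n S p) m =
      (\<Sum>g\<in>?F. if sm_monomial S g = m then Poly_Mapping.lookup p (sm_monomial S g) else 0)"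
    by (simp add: sm_component_def lookup_sum lookup_single when_def)
  also have "\<dots> = (\<Sum>m'\<in>sm_monomial S ` ?F. if m' = m then Poly_Mapping.lookup p m' else 0)"
    by (simp add: sum.reindex[OF inj])
  also have "\<dots> = (if m \<in> sm_monomial S ` ?F then Poly_Mapping.lookup p m else 0)"
    using fin by simp
  finally show ?thesis .
qed

lemma sm_component_zero [simp]: "sm_component n S 0 = 0"
  by (simp add: sm_component_def)

lemma sm_component_add: "sm_component n S (p + q) = sm_component n S p + sm_component n S q"
  by (simp add: sm_component_def lookup_add single_add sum.distrib)

text \<open>Every monomial of the component has degree \<open>card S\<close>. Homogeneity enters
  through this fact: a polynomial of degree \<open>k\<close> has nonzero components only on sets of
  \<open>k\<close> parts.\<close>

lemma sm_component_eq_zero: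
  assumes "finite S" "\<And>m. m \<in> Poly_Mapping.keys p \<Longrightarrow> mdegree m \<noteq> card S"
  shows "sm_component n S p = 0"
proof (rule poly_mapping_eqI)
  fix m
  show "Poly_Mapping.lookup (sm_component n S p) m = Poly_Mapping.lookup 0 m"
    using assms(2)[of m] mdegree_sm_monomial[OF assms(1)] by (fastforce simp: lookup_sm_component[OF assms(1)] in_keys_iff)
qed

text \<open>The exponents of a monomial of \<open>f\<close> within one part are natural numbers with
  sum 1, so exactly one of them is 1; its position is the value of the choice function.\<close>

lemma sm_component_set_multilinear:
  assumes "set_multilinear n d f"
  shows "sm_component n {..<d} f = f"
proof (rule poly_mapping_eqI)
  fix m
  have "m \<in> sm_monomial {..<d} ` ({..<d} \<rightarrow>\<^sub>E {..<n})" if m: "m \<in> Poly_Mapping.keys f"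
  proof -
    have supp: "Poly_Mapping.keys m \<subseteq> partition_vars n d"
      and one: "\<And>i. i < d \<Longrightarrow> (\<Sum>j<n. Poly_Mapping.lookup m (i, j)) = 1"
      using assms m by (auto simp: set_multilinear_def)
    have "\<exists>j<n. \<forall>j'<n. Poly_Mapping.lookup m (i, j') = (if j' = j then 1 else 0)" if i: "i < d" for i
      proof -
      obtain j where "j < n" "Poly_Mapping.lookup m (i, j) = 1"
        and "\<forall>j'\<in>{..<n}. j \<noteq> j' \<longrightarrow> Poly_Mapping.lookup m (i, j') = 0"
        using one[OF i] sum_eq_1_iff[of "{..<n}" "\<lambda>j. Poly_Mapping.lookup m (i, j)"] by auto
      then show ?thesis by (intro exI[of _ j]) auto
    qed
    then obtain g where g: "\<And>i. i < d \<Longrightarrow> g i < n"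
      "\<And>i j. i < d \<Longrightarrow> j < n \<Longrightarrow> Poly_Mapping.lookup m (i, j) = (if j = g i then 1 else 0)"
      by metis
    have "m = sm_monomial {..<d} (restrict g {..<d})"
    proof (rule poly_mapping_eqI)
      fix v :: "nat \<times> nat"
      obtain i j where v: "v = (i, j)" by fastforce
      show "Poly_Mapping.lookup m v = Poly_Mapping.lookup (sm_monomial {..<d} (restrict g {..<d})) v"
      proof (cases "v \<in> partition_vars n d")
        case True
        then show ?thesis using g by (auto simp: v lookup_sm_monomial partition_vars_def)
      next
        case False
        then have "Poly_Mapping.lookup m v = 0" using supp by (auto simp: in_keys_iff)
        then show ?thesis using False g(1)
          by (auto simp: v lookup_sm_monomial partition_vars_def)
      qed
    qed
    then show ?thesis using g(1) by (intro image_eqI[of _ _ "restrict g {..<d}"]) auto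
  qed
  then show "Poly_Mapping.lookup (sm_component n {..<d} f) m = Poly_Mapping.lookup f m"
    by (auto simp: lookup_sm_component in_keys_iff)
qed

section \<open>Components of a product\<close>

lemma sm_monomial_split:
  assumes "finite S" "A \<subseteq> S"
  shows "sm_monomial A g + sm_monomial (S - A) g = sm_monomial S g"
  unfolding sm_monomial_def sum.subset_diff[OF assms(2,1)] by (rule add.commute)

text \<open>All exponents on the left are 0 or 1, so each variable goes entirely to one of the two
  factors; \<open>A\<close> collects the parts whose variable goes to \<open>l\<close>.\<close>

lemma sm_monomial_eq_addD:
  assumes S: "finite S" and eq: "sm_monomial S g = l + l'"
  obtains A where "A \<subseteq> S" "l = sm_monomial A g"
proof
  let ?A = "{i\<in>S. Poly_Mapping.lookup l (i, g i) = 1}"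
  show "?A \<subseteq> S" by auto
  show "l = sm_monomial ?A g"
  proof (rule poly_mapping_eqI)
    fix v :: "nat \<times> nat"
    obtain i j where v: "v = (i, j)" by fastforce
    have "Poly_Mapping.lookup l v + Poly_Mapping.lookup l' v = (if i \<in> S \<and> j = g i then 1 else 0)"
      using S lookup_sm_monomial[of S g i j] by (simp add: eq v lookup_add)
    then show "Poly_Mapping.lookup l v = Poly_Mapping.lookup (sm_monomial ?A g) v"
      using S by (auto simp: v lookup_sm_monomial split: if_splits)
  qed
qed

text \<open>The factorisations of a multilinear monomial correspond to the subsets of
  \<open>S\<close>, which turns the convolution into a sum over \<open>Pow S\<close>.\<close>

lemma lookup_mult_sm_monomial:
  fixes p q :: "(nat \<times> nat, 'a::comm_ring_1) mpoly"
  assumes S: "finite S"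
  shows "Poly_Mapping.lookup (p * q) (sm_monomial S g) =
    (\<Sum>A\<in>Pow S. Poly_Mapping.lookup p (sm_monomial A g) * Poly_Mapping.lookup q (sm_monomial (S - A) g))"
proof -
  let ?D = "(\<lambda>A. sm_monomial A g) ` Pow S"
  \<comment> \<open>\<open>h l\<close> gathers the coefficients of \<open>q\<close> at the cofactors
    of \<open>l\<close>. There is none unless \<open>l\<close> divides the monomial, and then it is
    unique by cancellation.\<close>
  define h where "h l = (\<Sum>l'. (Poly_Mapping.lookup q l' when sm_monomial S g = l + l'))" for l
  have inj: "inj_on (\<lambda>A. sm_monomial A g) (Pow S)"
  proof (rule inj_onI)
    fix A B assume AB: "A \<in> Pow S" "B \<in> Pow S" "sm_monomial A g = sm_monomial B g"
    have fin: "finite A" "finite B" using AB S by (blast intro: finite_subset)+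
    have "(if i \<in> A then 1 else 0 :: nat) = (if i \<in> B then 1 else 0)" for i
      using lookup_sm_monomial[OF fin(1), of g i "g i"] lookup_sm_monomial[OF fin(2), of g i "g i"]
      unfolding AB(3) by (simp only: simp_thms)
    then have "i \<in> A \<longleftrightarrow> i \<in> B" for i by (metis zero_neq_one)
    then show "A = B" by blast
  qed
  have h0: "h l = 0" if "l \<notin> ?D" for l
  proof -
    have "sm_monomial S g \<noteq> l + l'" for l'
    proof
      assume "sm_monomial S g = l + l'"
      then obtain A where "A \<subseteq> S" "l = sm_monomial A g" by (rule sm_monomial_eq_addD[OF S])
      then show False using that by blast
    qed
    then have "(\<lambda>l'. Poly_Mapping.lookup q l' when sm_monomial S g = l + l') = (\<lambda>_. 0)" by simp
    then show ?thesis unfolding h_def by (simp only: Sum_any.neutral)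
  qed
  have h1: "h (sm_monomial A g) = Poly_Mapping.lookup q (sm_monomial (S - A) g)" if "A \<subseteq> S" for A
  proof -
    have "sm_monomial S g = sm_monomial A g + l' \<longleftrightarrow> l' = sm_monomial (S - A) g" for l'
      unfolding sm_monomial_split[OF S that, of g, symmetric] add_left_cancel by (rule eq_commute)
    then show ?thesis unfolding h_def by (simp only: Sum_any_when_equal)
  qed
  have "Poly_Mapping.lookup (p * q) (sm_monomial S g) = (\<Sum>l. Poly_Mapping.lookup p l * h l)"
    unfolding h_def by (rule lookup_mult)
  also have "\<dots> = (\<Sum>l\<in>?D. Poly_Mapping.lookup p l * h l)"
  proof (rule Sum_any.expand_superset)
    show "finite ?D" using S by simp
    show "{l. Poly_Mapping.lookup p l * h l \<noteq> 0} \<subseteq> ?D"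
    proof
      fix l assume "l \<in> {l. Poly_Mapping.lookup p l * h l \<noteq> 0}"
      then have "h l \<noteq> 0" by auto
      then show "l \<in> ?D" using h0 by blast
    qed
  qed
  also have "\<dots> = (\<Sum>A\<in>Pow S. Poly_Mapping.lookup p (sm_monomial A g) * h (sm_monomial A g))"
    by (simp add: sum.reindex[OF inj])
  also have "\<dots> = (\<Sum>A\<in>Pow S. Poly_Mapping.lookup p (sm_monomial A g) * Poly_Mapping.lookup q (sm_monomial (S - A) g))"
    by (rule sum.cong) (simp_all add: h1)
  finally show ?thesis .
qed

text \<open>A choice of variables on \<open>S\<close> is a pair of choices on \<open>A\<close> and
  on \<open>S - A\<close>, so for fixed \<open>A\<close> the sum over all choices factors.\<close>

lemma sm_component_mult:
  fixes p q :: "(nat \<times> nat, 'a::comm_ring_1) mpoly"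
  assumes S: "finite S"
  shows "sm_component n S (p * q) = (\<Sum>A\<in>Pow S. sm_component n A p * sm_component n (S - A) q)"
proof -
  let ?t = "\<lambda>A p g. Poly_Mapping.single (sm_monomial A g) (Poly_Mapping.lookup p (sm_monomial A g))"
  have split: "(\<Sum>g\<in>S \<rightarrow>\<^sub>E {..<n}. ?t A p g * ?t (S - A) q g) = sm_component n A p * sm_component n (S - A) q"
    if A: "A \<subseteq> S" for A
  proof -
    have "(\<Sum>g\<in>S \<rightarrow>\<^sub>E {..<n}. ?t A p g * ?t (S - A) q g) =
      (\<Sum>(g, h)\<in>(A \<rightarrow>\<^sub>E {..<n}) \<times> (S - A \<rightarrow>\<^sub>E {..<n}). ?t A p g * ?t (S - A) q h)"
    proof (rule sum.reindex_bij_witness[where j = "\<lambda>g. (restrict g A, restrict g (S - A))"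
          and i = "\<lambda>(g, h) i. if i \<in> A then g i else h i"], goal_cases)
      case (1 g)
      then show ?case using A by (auto simp: fun_eq_iff PiE_def extensional_def restrict_def)
    next
      case (2 g)
      then show ?case using A by (auto simp: PiE_def Pi_def extensional_def)
    next
      case (3 b)
      then show ?case using A by (auto simp: fun_eq_iff PiE_def extensional_def restrict_def)
    next
      case (4 b)
      then show ?case using A by (auto simp: PiE_def Pi_def extensional_def split: if_splits)
    next
      case (5 g)
      have "sm_monomial A (restrict g A) = sm_monomial A g"
        "sm_monomial (S - A) (restrict g (S - A)) = sm_monomial (S - A) g"
        by (rule sm_monomial_cong; simp)+
      then show ?case by simp
    qed
    also have "\<dots> = sm_component n A p * sm_component n (S - A) q"
      by (simp add: sm_component_def sum_product sum.cartesian_product)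
    finally show ?thesis .
  qed
  have single_sum: "Poly_Mapping.single m (\<Sum>x\<in>X. F x) = (\<Sum>x\<in>X. Poly_Mapping.single m (F x))"
    for m :: "(nat \<times> nat) monomial" and X :: "nat set set" and F :: "nat set \<Rightarrow> 'a"
    by (induction X rule: infinite_finite_induct) (simp_all add: single_add)
  have "sm_component n S (p * q) = (\<Sum>g\<in>S \<rightarrow>\<^sub>E {..<n}. \<Sum>A\<in>Pow S. ?t A p g * ?t (S - A) q g)"
    unfolding sm_component_def lookup_mult_sm_monomial[OF S] single_sum
    by (intro sum.cong refl) (simp add: mult_single sm_monomial_split[OF S])
  also have "\<dots> = (\<Sum>A\<in>Pow S. \<Sum>g\<in>S \<rightarrow>\<^sub>E {..<n}. ?t A p g * ?t (S - A) q g)"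
    by (rule sum.swap)
  also have "\<dots> = (\<Sum>A\<in>Pow S. sm_component n A p * sm_component n (S - A) q)"
    by (intro sum.cong refl split) auto
  finally show ?thesis .
qed

section \<open>Rank of components\<close>

text \<open>The scalars matter only for \<open>S = {}\<close>, where a product of linear forms is empty.\<close>

inductive sm_rank_le :: "nat \<Rightarrow> nat set \<Rightarrow> nat \<Rightarrow> (nat \<times> nat, 'a::comm_ring_1) mpoly \<Rightarrow> bool"
  for n :: nat and S :: "nat set" where
  zero: "sm_rank_le n S 0 0"
| step: "sm_rank_le n S r p \<Longrightarrow> (\<And>i. i \<in> S \<Longrightarrow> linear_form_in_part n i (l i)) \<Longrightarrow>
    sm_rank_le n S (Suc r) (p + mconst a * (\<Prod>i\<in>S. l i))"

lemma sm_rank_le_add: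
  assumes "sm_rank_le n S r p" "sm_rank_le n S t q"
  shows "sm_rank_le n S (r + t) (p + q)"
  using assms(2)
proof induction
  case zero
  then show ?case using assms(1) by simp
next
  case (step t q l a)
  then show ?case using sm_rank_le.step[OF step.IH step.hyps(2), of a] by (simp add: add.assoc)
qed

text \<open>As \<open>A\<close> and \<open>B\<close> are disjoint, a term over \<open>A\<close>
  times a term over \<open>B\<close> is one term over \<open>A \<union> B\<close>: the linear forms
  are put side by side and the scalars multiplied. Expanding the product gives \<open>r * t\<close>
  terms.\<close>

lemma sm_rank_le_mult:
  assumes fin: "finite A" "finite B" and disj: "A \<inter> B = {}"
    and p: "sm_rank_le n A r p" and q: "sm_rank_le n B t q"
  shows "sm_rank_le n (A \<union> B) (r * t) (p * q)"
proof -
  have term_rank: "sm_rank_le n (A \<union> B) t (mconst a * (\<Prod>i\<in>A. l i) * q)"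
    if l: "\<And>i. i \<in> A \<Longrightarrow> linear_form_in_part n i (l i)" for l a
    using q
  proof induction
    case zero
    then show ?case by (simp add: sm_rank_le.zero)
  next
    case (step t q l' b)
    let ?k = "\<lambda>i. if i \<in> A then l i else l' i"
    have k: "linear_form_in_part n i (?k i)" if "i \<in> A \<union> B" for i
      using that l step.hyps(2) by auto
    have "(\<Prod>i\<in>A \<union> B. ?k i) = (\<Prod>i\<in>A. ?k i) * (\<Prod>i\<in>B. ?k i)"
      by (rule prod.union_disjoint[OF fin disj])
    also have "(\<Prod>i\<in>B. ?k i) = (\<Prod>i\<in>B. l' i)" using disj by (intro prod.cong) auto
    finally have prod: "(\<Prod>i\<in>A \<union> B. ?k i) = (\<Prod>i\<in>A. l i) * (\<Prod>i\<in>B. l' i)" by simp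
    have "mconst (a * b) = mconst a * (mconst b :: (nat \<times> nat, 'a) mpoly)"
      by (simp add: mconst_def mult_single)
    then show ?case
      using sm_rank_le.step[OF step.IH k, of "a * b"] by (simp add: prod algebra_simps)
  qed
  show ?thesis using p
  proof induction
    case zero
    then show ?case by (simp add: sm_rank_le.zero)
  next
    case (step r p l a)
    show ?case
      using sm_rank_le_add[OF step.IH term_rank[OF step.hyps(2), of a]] by (simp add: algebra_simps)
  qed
qed

lemma sm_rank_le_single:
  assumes "\<And>i. i \<in> S \<Longrightarrow> linear_form_in_part n i (l i)"
  shows "sm_rank_le n S 1 (mconst a * (\<Prod>i\<in>S. l i))"
  using sm_rank_le.step[where l = l and a = a, OF sm_rank_le.zero assms] by simp

lemma sm_rank_le_sum_card:
  assumes "finite X" "\<And>x. x \<in> X \<Longrightarrow> sm_rank_le n S 1 (F x)"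
  shows "sm_rank_le n S (card X) (\<Sum>x\<in>X. F x)"
  using assms
proof (induction X rule: finite_induct)
  case empty
  then show ?case by (simp add: sm_rank_le.zero)
next
  case (insert x X)
  then show ?case using sm_rank_le_add[of n S 1 "F x" "card X"] by auto
qed

lemma linear_form_in_part_mvar:
  assumes "j < n" shows "linear_form_in_part n i (mvar (i, j))"
  unfolding linear_form_in_part_def
proof
  have *: "(mconst (if j' = j then 1 else 0) :: (nat \<times> nat, 'a) mpoly) * mvar (i, j') =
      (if j' = j then mvar (i, j') else 0)" for j'
    by (simp add: mconst_def)
  show "mvar (i, j) = (\<Sum>j'<n. mconst (if j' = j then 1 else 0 :: 'a) * mvar (i, j'))"
    using assms by (simp add: *)
qed

lemma prod_mvar_eq_single:
  assumes "finite S"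
  shows "(\<Prod>i\<in>S. mvar (i, g i)) = Poly_Mapping.single (sm_monomial S g) (1 :: 'a::comm_ring_1)"
  using assms
  by (induction S rule: finite_induct) (simp_all add: sm_monomial_def mvar_def mult_single)

lemma sm_rank_le_component_empty: "sm_rank_le n {} 1 (sm_component n {} p)"
  using sm_rank_le_single[of "{}" n undefined "Poly_Mapping.lookup p 0"]
  by (simp add: sm_component_def sm_monomial_def mconst_def)

text \<open>The trivial bound: one part \<open>i0\<close> is singled out, and all monomials that
  agree on the other parts are merged into a single product. There are
  \<open>n ^ (card S - 1)\<close> choices on the other parts.\<close>

lemma sm_rank_le_component:
  fixes p :: "(nat \<times> nat, 'a::comm_ring_1) mpoly"
  assumes S: "finite S" "S \<noteq> {}"
  shows "sm_rank_le n S (n ^ (card S - 1)) (sm_component n S p)"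
proof -
  obtain i0 T where T: "S = insert i0 T" "i0 \<notin> T" using S(2) by (metis Set.set_insert equals0I)
  have fT: "finite T" using S T by simp
  let ?G = "T \<rightarrow>\<^sub>E {..<n}"
  define c where "c j g = Poly_Mapping.lookup p (sm_monomial S (g(i0 := j)))" for j g
  \<comment> \<open>The form at \<open>i0\<close> carries all the coefficients, and the other forms
    are single variables.\<close>
  define l where "l g i = (if i = i0 then \<Sum>j<n. mconst (c j g) * mvar (i0, j) else mvar (i, g i))"
    for g i
  have mono: "sm_monomial S (g(i0 := j)) = Poly_Mapping.single (i0, j) 1 + sm_monomial T g" for g j
    using T fT by (auto simp: sm_monomial_def intro!: sum.cong)
  have prodl: "(\<Prod>i\<in>S. l g i) = (\<Sum>j<n. Poly_Mapping.single (sm_monomial S (g(i0 := j))) (c j g))" for g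
  proof -
    have "(\<Prod>i\<in>S. l g i) = (\<Sum>j<n. mconst (c j g) * mvar (i0, j)) * (\<Prod>i\<in>T. mvar (i, g i))"
    proof -
      have "(\<Prod>i\<in>T. l g i) = (\<Prod>i\<in>T. mvar (i, g i))"
        using T(2) by (intro prod.cong) (auto simp: l_def)
      then show ?thesis using T fT by (simp add: l_def[of g i0])
    qed
    also have "\<dots> = (\<Sum>j<n. Poly_Mapping.single (sm_monomial S (g(i0 := j))) (c j g))"
      unfolding prod_mvar_eq_single[OF fT] sum_distrib_right mono
      by (simp add: mconst_def mvar_def mult_single)
    finally show ?thesis .
  qed
  have rank: "sm_rank_le n S 1 (\<Prod>i\<in>S. l g i)" if "g \<in> ?G" for g
  proof -
    have "linear_form_in_part n i (l g i)" if "i \<in> S" for i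
    proof (cases "i = i0")
      case True
      then show ?thesis by (auto simp: l_def linear_form_in_part_def)
    next
      case False
      then show ?thesis
        using \<open>g \<in> ?G\<close> that T by (auto simp: l_def PiE_def Pi_def intro!: linear_form_in_part_mvar)
    qed
    then show ?thesis using sm_rank_le_single[of S n "l g" 1] by (simp add: mconst_def)
  qed
  have "sm_component n S p = (\<Sum>(j, g)\<in>{..<n} \<times> ?G. Poly_Mapping.single (sm_monomial S (g(i0 := j))) (c j g))"
    unfolding sm_component_def T(1) PiE_insert_eq
    by (subst sum.reindex[OF inj_combinator[OF T(2)]]) (simp add: c_def T(1) split_def)
  also have "\<dots> = (\<Sum>g\<in>?G. \<Sum>j<n. Poly_Mapping.single (sm_monomial S (g(i0 := j))) (c j g))"
    by (subst sum.swap) (simp add: sum.cartesian_product)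
  also have "\<dots> = (\<Sum>g\<in>?G. \<Prod>i\<in>S. l g i)" by (simp add: prodl)
  finally have "sm_component n S p = (\<Sum>g\<in>?G. \<Prod>i\<in>S. l g i)" .
  moreover have "card ?G = n ^ (card S - 1)" using T fT by (simp add: card_PiE)
  moreover have "finite ?G" using fT by (simp add: finite_PiE)
  ultimately show ?thesis using sm_rank_le_sum_card[of ?G n S "\<lambda>g. \<Prod>i\<in>S. l g i"] rank by simp
qed

text \<open>The scalar of each term is absorbed into its linear form for part 0, which exists as
  \<open>d \<ge> 1\<close>.\<close>

lemma tensor_rank_le:
  fixes f :: "(nat \<times> nat, 'a::comm_ring_1) mpoly"
  assumes d: "d \<ge> 1" and f: "sm_rank_le n {..<d} r f"
  shows "tensor_rank n d f \<le> r"
proof -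
  have "\<exists>l. (\<forall>k<r. \<forall>i<d. linear_form_in_part n i (l k i)) \<and> f = (\<Sum>k<r. \<Prod>i<d. l k i)"
    using f
  proof induction
    case zero
    then show ?case by simp
  next
    case (step r p l a)
    then obtain L where L: "\<forall>k<r. \<forall>i<d. linear_form_in_part n i (L k i)" "p = (\<Sum>k<r. \<Prod>i<d. L k i)"
      by blast
    let ?l = "\<lambda>i. if i = 0 then mconst a * l 0 else l i"
    have lin: "linear_form_in_part n i (?l i)" if "i < d" for i
    proof (cases "i = 0")
      case True
      obtain b where b: "l 0 = (\<Sum>j<n. mconst (b j) * mvar (0, j))"
        using step.hyps(2)[of 0] d by (auto simp: linear_form_in_part_def)
      have "mconst a * l 0 = (\<Sum>j<n. mconst (a * b j) * mvar (0, j))"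
        by (simp add: b sum_distrib_left mult.assoc[symmetric]) (simp add: mconst_def mult_single)
      then show ?thesis using True by (auto simp: linear_form_in_part_def)
    next
      case False
      then show ?thesis using step.hyps(2) that by simp
    qed
    have d0: "{..<d} = insert 0 {1..<d}" using d by auto
    have "(\<Prod>i<d. ?l i) = mconst a * (\<Prod>i<d. l i)"
      unfolding d0 by (simp add: mult.assoc)
    then show ?case
      using L lin by (intro exI[of _ "\<lambda>k. if k = r then ?l else L k"]) (auto simp: less_Suc_eq)
  qed
  then show ?thesis unfolding tensor_rank_def by (rule Least_le)
qed

section \<open>The saving function and its recurrence\<close>

text \<open>For \<open>c \<ge> 0\<close> the value 0 at \<open>k = 0\<close> and the summand 1 give
  weight 1 to the empty set and to single parts. The slope keeps the linear branch at most
  \<open>c + 1\<close> up to twice the threshold.\<close>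

definition saving :: "real \<Rightarrow> nat \<Rightarrow> real" where
  "saving c k = (if k = 0 then 0 else if real k \<le> 2 powr c then log 2 (real k) + 1
     else c + real k / (2 * 2 powr c))"

text \<open>The factorial pays for the number of ways to split \<open>S\<close> at a product:
  \<open>(s choose k) * k! * (s - k)! = s!\<close>.\<close>

definition weight :: "nat \<Rightarrow> real \<Rightarrow> nat \<Rightarrow> real" where
  "weight n c k = fact k * real n powr (real k - saving c k)"

lemma weight_nonneg: "weight n c k \<ge> 0"
  by (simp add: weight_def)

text \<open>The first alternative serves the trivial bound for the factor of smaller degree
  \<open>b\<close>, the second the inductive bound with its extra cost \<open>c\<close>. The second
  is used only if both degrees exceed \<open>2 powr c\<close>.\<close>

lemma saving_add:
  assumes c: "c \<ge> 0" and b: "1 \<le> b" "b \<le> a"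
  shows "saving c (a + b) \<le> saving c a + 1 \<or> saving c (a + b) + c \<le> saving c a + saving c b"
proof -
  let ?T = "2 powr c"
  have T: "?T > 0" by simp
  have log2: "log 2 (real (a + b)) \<le> log 2 (real a) + 1"
  proof -
    have "log 2 (real (a + b)) \<le> log 2 (2 * real a)" using b by (intro log_mono) auto
    also have "\<dots> = log 2 (real a) + 1" using b by (simp add: log_mult)
    finally show ?thesis .
  qed
  consider "real (a + b) \<le> ?T" | "real a \<le> ?T" "real (a + b) > ?T"
    | "real a > ?T" "real b \<le> ?T" | "real a > ?T" "real b > ?T"
    by linarith
  then show ?thesis
  proof cases
    case 1
    then have "real a \<le> ?T" by simp
    then show ?thesis using 1 b log2 by (simp add: saving_def)
  next
    case 2
    \<comment> \<open>Since \<open>a + b \<le> 2 * a \<le> 2 * ?T\<close>, the linear branch is at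
      most \<open>c + 1\<close>, hence at most the logarithmic formula at
      \<open>a + b\<close>.\<close>
    have "real (a + b) / (2 * ?T) \<le> 1" using 2(1) b T by (simp add: divide_le_eq)
    moreover have "c \<le> log 2 (real (a + b))" using 2(2) b by (simp add: le_log_iff)
    ultimately have "c + real (a + b) / (2 * ?T) \<le> log 2 (real (a + b)) + 1" by linarith
    then have "saving c (a + b) \<le> log 2 (real (a + b)) + 1"
      using 2(2) b by (simp add: saving_def del: of_nat_add)
    then show ?thesis using 2 b log2 by (simp add: saving_def)
  next
    case 3
    have "real b / (2 * ?T) \<le> 1" using 3 T by (simp add: field_simps)
    then show ?thesis using 3 b by (simp add: saving_def add_divide_distrib)
  next
    case 4
    \<comment> \<open>The linear terms add up exactly, and the constant \<open>c\<close> occurs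
      twice on the right, which leaves the required \<open>c\<close>.\<close>
    then show ?thesis using b by (simp add: saving_def add_divide_distrib)
  qed
qed

text \<open>\<open>P\<close> and \<open>Q\<close> stand for formula sizes. Only \<open>P\<close>,
  the size belonging to the larger degree, survives in \<open>R\<close>: \<open>Q\<close> is either
  absent or absorbed through \<open>Q \<le> n powr c\<close>. Hence sizes do not multiply along the
  formula.\<close>

lemma weight_mult:
  fixes P Q :: real
  assumes n: "n \<ge> 1" and c: "c \<ge> 0" and ba: "b \<le> a" and P: "P \<ge> 0" and Q: "0 \<le> Q" "Q \<le> real n powr c"
  defines "R \<equiv> P * (fact a * fact b) * real n powr (real (a + b) - saving c (a + b))"
  shows "(P * weight n c a) * real n ^ (b - 1) \<le> R \<or> (P * weight n c a) * (Q * weight n c b) \<le> R"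
proof (cases "b = 0")
  case True
  \<comment> \<open>The first alternative is an equality here, because \<open>b - 1\<close> is
    truncated to 0.\<close>
  then show ?thesis by (simp add: R_def weight_def)
next
  case False
  let ?N = "real n"
  have N: "?N \<ge> 1" "?N > 0" using n by auto
  from False have b: "1 \<le> b" by simp
  from saving_add[OF c b ba] show ?thesis
  proof
    assume s: "saving c (a + b) \<le> saving c a + 1"
    have "(P * weight n c a) * ?N ^ (b - 1) = P * fact a * ?N powr (real a - saving c a + real (b - 1))"
      using N by (simp add: weight_def powr_add powr_realpow)
    also have "\<dots> \<le> P * (fact a * fact b) * ?N powr (real (a + b) - saving c (a + b))"
    proof (rule mult_mono[OF _ powr_mono])
      show "P * fact a \<le> P * (fact a * fact b)"
        using P by (intro mult_left_mono) (auto simp: mult_le_cancel_left1 fact_ge_1)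
      show "real a - saving c a + real (b - 1) \<le> real (a + b) - saving c (a + b)"
        using s b by (simp add: of_nat_diff)
    qed (use N P in auto)
    finally show ?thesis by (simp add: R_def)
  next
    assume s: "saving c (a + b) + c \<le> saving c a + saving c b"
    have "(P * weight n c a) * (Q * weight n c b) =
      P * (fact a * fact b) * (Q * ?N powr ((real a - saving c a) + (real b - saving c b)))"
      by (simp add: weight_def powr_add)
    also have "\<dots> \<le> P * (fact a * fact b) * (?N powr c * ?N powr ((real a - saving c a) + (real b - saving c b)))"
      using P Q by (intro mult_left_mono mult_right_mono) auto
    also have "\<dots> = P * (fact a * fact b) * ?N powr (c + ((real a - saving c a) + (real b - saving c b)))"
      by (simp add: powr_add)
    also have "\<dots> \<le> P * (fact a * fact b) * ?N powr (real (a + b) - saving c (a + b))"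
      using P N s by (intro mult_left_mono powr_mono) auto
    finally show ?thesis by (simp add: R_def)
  qed
qed

section \<open>Rank bounds along a formula\<close>

definition rank_bound :: "nat \<Rightarrow> nat set \<Rightarrow> real \<Rightarrow> (nat \<times> nat, 'a::comm_ring_1) mpoly \<Rightarrow> bool" where
  "rank_bound n S b p \<longleftrightarrow> (\<exists>r. real r \<le> b \<and> sm_rank_le n S r p)"

lemma rank_bound_mono: "rank_bound n S b p \<Longrightarrow> b \<le> b' \<Longrightarrow> rank_bound n S b' p"
  unfolding rank_bound_def by (meson order_trans)

lemma rank_bound_nonneg: "rank_bound n S b p \<Longrightarrow> 0 \<le> b"
  unfolding rank_bound_def by (meson of_nat_0_le_iff order_trans)

lemma rank_bound_zero: "b \<ge> 0 \<Longrightarrow> rank_bound n S b 0"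
  unfolding rank_bound_def by (intro exI[of _ 0]) (simp add: sm_rank_le.zero)

lemma rank_bound_add:
  assumes "rank_bound n S b p" "rank_bound n S b' q"
  shows "rank_bound n S (b + b') (p + q)"
proof -
  obtain r t where "real r \<le> b" "sm_rank_le n S r p" "real t \<le> b'" "sm_rank_le n S t q"
    using assms by (auto simp: rank_bound_def)
  then show ?thesis
    unfolding rank_bound_def by (intro exI[of _ "r + t"]) (auto intro: sm_rank_le_add)
qed

lemma rank_bound_sum:
  assumes "finite X" "\<And>x. x \<in> X \<Longrightarrow> rank_bound n S b (F x)"
  shows "rank_bound n S (real (card X) * b) (\<Sum>x\<in>X. F x)"
  using assms
proof (induction X rule: finite_induct)
  case empty
  then show ?case by (simp add: rank_bound_zero)
next
  case (insert x X)
  then show ?case using rank_bound_add[of n S b "F x" "real (card X) * b" "sum F X"] by (simp add: algebra_simps)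
qed

lemma rank_bound_mult:
  assumes "finite S" "A \<subseteq> S" "rank_bound n A b p" "rank_bound n (S - A) b' q"
  shows "rank_bound n S (b * b') (p * q)"
proof -
  obtain r t where rt: "real r \<le> b" "sm_rank_le n A r p" "real t \<le> b'" "sm_rank_le n (S - A) t q"
    using assms by (auto simp: rank_bound_def)
  have "finite A" using assms finite_subset by blast
  then have "sm_rank_le n (A \<union> (S - A)) (r * t) (p * q)"
    using assms(1) rt by (intro sm_rank_le_mult) auto
  moreover have "A \<union> (S - A) = S" using assms(2) by auto
  moreover have "real (r * t) \<le> b * b'"
    using rt rank_bound_nonneg[OF assms(3)] by (simp add: mult_mono)
  ultimately show ?thesis unfolding rank_bound_def by metis
qed

text \<open>For empty \<open>S\<close> the truncated exponent is 0, and the bound 1 is right because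
  a constant is one scaled empty product.\<close>

lemma rank_bound_component:
  assumes "finite S"
  shows "rank_bound n S (real n ^ (card S - 1)) (sm_component n S p)"
proof (cases "S = {}")
  case True
  then show ?thesis
    using sm_rank_le_component_empty[of n p] by (auto simp: rank_bound_def)
next
  case False
  then show ?thesis
    unfolding rank_bound_def using sm_rank_le_component[OF assms False, of n p]
    by (intro exI[of _ "n ^ (card S - 1)"]) simp
qed

text \<open>If \<open>p\<close> is homogeneous of degree \<open>k\<close>, only the sets
  \<open>A\<close> of size \<open>k\<close> contribute. Each contribution is bounded by
  \<open>weight_mult\<close>, with the larger of \<open>A\<close> and \<open>S - A\<close> in the
  role of \<open>a\<close>, and the binomial number of such sets turns the two factorials into that
  of \<open>card S\<close>.\<close>

lemma rank_bound_component_mult: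
  fixes p q :: "(nat \<times> nat, 'a::comm_ring_1) mpoly" and P Q :: real
  assumes n: "n \<ge> 1" and c: "c \<ge> 0" and PQ: "P \<ge> 0" "Q \<ge> 0" "P + Q \<le> real n powr c"
    and hom: "homogeneous p"
    and p: "\<And>A. finite A \<Longrightarrow> rank_bound n A (P * weight n c (card A)) (sm_component n A p)"
    and q: "\<And>A. finite A \<Longrightarrow> rank_bound n A (Q * weight n c (card A)) (sm_component n A q)"
    and S: "finite S"
  shows "rank_bound n S ((P + Q) * weight n c (card S)) (sm_component n S (p * q))"
proof -
  \<comment> \<open>For \<open>p = 0\<close> the degree \<open>k\<close> is arbitrary and may exceed
    \<open>card S\<close>.\<close>
  obtain k where k: "\<And>m. m \<in> Poly_Mapping.keys p \<Longrightarrow> mdegree m = k"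
    using hom by (auto simp: homogeneous_def)
  let ?s = "card S"
  let ?X = "{A. A \<subseteq> S \<and> card A = k}"
  let ?E = "real n powr (real ?s - saving c ?s)"
  let ?B = "(P + Q) * (fact k * fact (?s - k)) * ?E"
  have "sm_component n A p = 0" if "A \<in> Pow S - ?X" for A
    using that k S finite_subset[of A S] by (intro sm_component_eq_zero) auto
  then have eq: "sm_component n S (p * q) = (\<Sum>A\<in>?X. sm_component n A p * sm_component n (S - A) q)"
    unfolding sm_component_mult[OF S] using S by (intro sum.mono_neutral_right) auto
  have each: "rank_bound n S ?B (sm_component n A p * sm_component n (S - A) q)" if A: "A \<in> ?X" for A
  proof -
    let ?a = "card A" and ?b = "card (S - A)"
    have AS: "A \<subseteq> S" "finite A" "finite (S - A)" using A S finite_subset[of A S] by auto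
    have cards: "?a = k" "?b = ?s - k" "?a + ?b = ?s"
      using A AS S card_mono[OF S AS(1)] by (auto simp: card_Diff_subset)
    have B1: "P * (fact ?a * fact ?b) * real n powr (real (?a + ?b) - saving c (?a + ?b)) \<le> ?B"
      and B2: "Q * (fact ?b * fact ?a) * real n powr (real (?b + ?a) - saving c (?b + ?a)) \<le> ?B"
      unfolding add.commute[of ?b ?a] mult.commute[of "fact ?b"] cards(3)
      unfolding cards(1,2)
      using PQ by (auto intro!: mult_right_mono)
    note pq = rank_bound_mult[OF S AS(1)]
    show ?thesis
    proof (cases "?b \<le> ?a")
      case True
      have "Q \<le> real n powr c" using PQ by linarith
      from weight_mult[OF n c True PQ(1,2) this] show ?thesis
      proof
        show ?thesis if "P * weight n c ?a * real n ^ (?b - 1)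
            \<le> P * (fact ?a * fact ?b) * real n powr (real (?a + ?b) - saving c (?a + ?b))"
          by (rule rank_bound_mono[OF pq[OF p[OF AS(2)] rank_bound_component[OF AS(3)]] order_trans[OF that B1]])
        show ?thesis if "P * weight n c ?a * (Q * weight n c ?b)
            \<le> P * (fact ?a * fact ?b) * real n powr (real (?a + ?b) - saving c (?a + ?b))"
          by (rule rank_bound_mono[OF pq[OF p[OF AS(2)] q[OF AS(3)]] order_trans[OF that B1]])
      qed
    next
      case False
      \<comment> \<open>The roles are exchanged: the component of \<open>q\<close> lives on the
        larger set, so \<open>Q\<close> is the size factor that is kept.\<close>
      then have ab: "?a \<le> ?b" by simp
      have "P \<le> real n powr c" using PQ by linarith
      from weight_mult[OF n c ab PQ(2,1) this] show ?thesis
      proof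
        show ?thesis if "Q * weight n c ?b * real n ^ (?a - 1)
            \<le> Q * (fact ?b * fact ?a) * real n powr (real (?b + ?a) - saving c (?b + ?a))"
          using pq[OF rank_bound_component[OF AS(2)] q[OF AS(3)]] order_trans[OF that B2]
          unfolding mult.commute[of _ "real n ^ (?a - 1)"] by (rule rank_bound_mono)
        show ?thesis if "Q * weight n c ?b * (P * weight n c ?a)
            \<le> Q * (fact ?b * fact ?a) * real n powr (real (?b + ?a) - saving c (?b + ?a))"
          using pq[OF p[OF AS(2)] q[OF AS(3)]] order_trans[OF that B2]
          unfolding mult.commute[of _ "P * weight n c ?a"] by (rule rank_bound_mono)
      qed
    qed
  qed
  have fX: "finite ?X" using S by simp
  have "rank_bound n S (real (card ?X) * ?B) (sm_component n S (p * q))"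
    unfolding eq by (rule rank_bound_sum[OF fX each])
  moreover have "real (card ?X) * ?B \<le> (P + Q) * weight n c ?s"
  proof (cases "k \<le> ?s")
    case True
    have "real (?s choose k) * (fact k * fact (?s - k)) = fact ?s"
      using binomial_fact[OF True, where 'a = real] by simp
    moreover have "real (?s choose k) * ?B = (P + Q) * (real (?s choose k) * (fact k * fact (?s - k))) * ?E"
      by (simp only: mult_ac)
    ultimately show ?thesis using n_subsets[OF S, of k] by (simp only: weight_def mult.assoc order_refl)
  next
    case False
    \<comment> \<open>No subset of \<open>S\<close> has size \<open>k\<close>, so the sum is empty
      and it is enough that the right side is nonnegative.\<close>
    then have "?s choose k = 0" by (simp add: binomial_eq_0)
    then have "card ?X = 0" using n_subsets[OF S, of k] by simp
    then show ?thesis using PQ by (simp only: of_nat_0 mult_zero_left) (simp add: weight_nonneg)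
  qed
  ultimately show ?thesis by (rule rank_bound_mono)
qed

lemma homogeneous_formula_imp_homogeneous:
  "homogeneous_formula F \<Longrightarrow> homogeneous (formula_poly F)"
  by (cases F) auto

lemma weight_0 [simp]: "n \<ge> 1 \<Longrightarrow> weight n c 0 = 1"
  by (simp add: weight_def saving_def)

lemma weight_1: "n \<ge> 1 \<Longrightarrow> c \<ge> 0 \<Longrightarrow> weight n c 1 = 1"
  by (simp add: weight_def saving_def ge_one_powr_ge_zero)

lemma rank_bound_mconst:
  assumes "n \<ge> 1" "finite S"
  shows "rank_bound n S (weight n c (card S)) (sm_component n S (mconst a))"
proof (cases "S = {}")
  case True
  then show ?thesis using rank_bound_component[of S n "mconst a"] assms by simp
next
  case False
  then have "sm_component n S (mconst a) = 0"
    using assms by (intro sm_component_eq_zero) (auto simp: mconst_def mdegree_def split: if_splits)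
  then show ?thesis by (simp add: rank_bound_zero weight_nonneg)
qed

text \<open>On a single part the trivial bound is \<open>n ^ 0 = 1\<close>, which is the weight
  because \<open>saving c 1 = 1\<close>; on any other set the degree is wrong.\<close>

lemma rank_bound_mvar:
  assumes "n \<ge> 1" "c \<ge> 0" "finite S"
  shows "rank_bound n S (weight n c (card S)) (sm_component n S (mvar v :: (nat \<times> nat, 'a::comm_ring_1) mpoly))"
proof (cases "card S = 1")
  case True
  then show ?thesis using rank_bound_component[of S n "mvar v"] weight_1[OF assms(1,2)] assms(3) by simp
next
  case False
  then have "sm_component n S (mvar v :: (nat \<times> nat, 'a) mpoly) = 0"
    using assms by (intro sm_component_eq_zero) (auto simp: mvar_def mdegree_def)
  then show ?thesis by (simp add: rank_bound_zero weight_nonneg)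
qed

text \<open>Gates of unbounded fan-in are treated by an inner induction that splits off one child at
  a time. The size hypothesis passes to all subformulas and partial lists, so an absorbed size
  factor costs at most \<open>n powr c\<close>.\<close>

lemma rank_bound_formula:
  fixes F :: "(nat \<times> nat, 'a::comm_ring_1) formula"
  assumes n: "n \<ge> 1" and c: "c \<ge> 0"
    and "homogeneous_formula F" "real (formula_size F) \<le> real n powr c" "finite S"
  shows "rank_bound n S (real (formula_size F) * weight n c (card S)) (sm_component n S (formula_poly F))"
  using assms(3-)
proof (induction F arbitrary: S)
  case (Var v)
  then show ?case using rank_bound_mvar[OF n c] by simp
next
  case (Const a)
  then show ?case using rank_bound_mconst[OF n] by simp
next
  case (Add Fs)
  have "rank_bound n S (real (1 + sum_list (map formula_size Gs)) * weight n c (card S))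
      (sm_component n S (sum_list (map formula_poly Gs)))"
    if "set Gs \<subseteq> set Fs" "real (1 + sum_list (map formula_size Gs)) \<le> real n powr c" for Gs
    using that
  proof (induction Gs)
    case Nil
    then show ?case by (simp add: rank_bound_zero weight_nonneg)
  next
    case (Cons G Gs)
    have "rank_bound n S (real (formula_size G) * weight n c (card S)) (sm_component n S (formula_poly G))"
      using Cons.prems Add by (intro Add.IH) auto
    from rank_bound_add[OF this Cons.IH] Cons.prems show ?case
      by (simp add: sm_component_add algebra_simps)
  qed
  from this[of Fs] Add.prems show ?case by simp
next
  case (Mult Fs)
  \<comment> \<open>The summand 1 counts the gate itself; it pays for the empty product, which is
    the constant 1.\<close>
  have "rank_bound n A (real (1 + sum_list (map formula_size Gs)) * weight n c (card A))
      (sm_component n A (prod_list (map formula_poly Gs)))"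
    if "set Gs \<subseteq> set Fs" "real (1 + sum_list (map formula_size Gs)) \<le> real n powr c" "finite A" for Gs A
    using that
  proof (induction Gs arbitrary: A)
    case Nil
    then show ?case using rank_bound_mconst[OF n Nil(3), of c 1] by (simp add: mconst_def)
  next
    case (Cons G Gs)
    have G: "homogeneous_formula G" "G \<in> set Fs" using Cons.prems Mult.prems(1) by auto
    have p: "rank_bound n B (real (formula_size G) * weight n c (card B)) (sm_component n B (formula_poly G))"
      if "finite B" for B
      using Cons.prems that G by (intro Mult.IH) auto
    have q: "rank_bound n B (real (1 + sum_list (map formula_size Gs)) * weight n c (card B))
        (sm_component n B (prod_list (map formula_poly Gs)))" if "finite B" for B
      using Cons.prems that by (intro Cons.IH) auto
    have sz: "real (formula_size G) + real (1 + sum_list (map formula_size Gs)) \<le> real n powr c"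
      using Cons.prems(2) by simp
    \<comment> \<open>The homogeneous factor is the first one, a subformula of \<Phi> in the
      application.\<close>
    show ?case
      using rank_bound_component_mult[OF n c _ _ sz homogeneous_formula_imp_homogeneous[OF G(1)] p q \<open>finite A\<close>]
      by (simp add: algebra_simps)
  qed
  from this[of Fs S] Mult.prems show ?case by simp
qed

section \<open>The final estimate for large \<open>n\<close>\<close>

theorem theorem5p10:
  "\<exists>e :: real \<Rightarrow> real. e \<in> O(\<lambda>c. c) \<and>
     (\<forall>(c::real) > 0. \<forall>d :: nat \<Rightarrow> nat.
        (\<forall>n. d n \<ge> 1) \<longrightarrow>
        (\<lambda>n. ln (real (d n))) \<in> o(\<lambda>n. ln (real n)) \<longrightarrow>
        (\<forall>\<^sub>F n in sequentially.
           \<forall>(f :: (nat \<times> nat, 'a::field) mpoly) (\<Phi> :: (nat \<times> nat, 'a) formula).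
             set_multilinear n (d n) f \<longrightarrow>
             formula_vars \<Phi> \<subseteq> partition_vars n (d n) \<longrightarrow>
             homogeneous_formula \<Phi> \<longrightarrow>
             formula_poly \<Phi> = f \<longrightarrow>
             real (formula_size \<Phi>) \<le> real n powr c \<longrightarrow>
             real (tensor_rank n (d n) f) \<le>
               real n ^ d n / real n powr (real (d n) / 2 powr e c)))"
proof (intro exI[of _ "\<lambda>c. c + 2"] conjI allI impI)
  show "(\<lambda>c::real. c + 2) \<in> O(\<lambda>c. c)"
    \<comment> \<open>For \<open>c \<ge> 1\<close> one has \<open>c + 2 \<le> 3 * c\<close>.\<close>
    by (rule bigoI[of _ 3]) (auto intro!: eventually_mono[OF eventually_ge_at_top[of 1]])
next
  fix c :: real and d :: "nat \<Rightarrow> nat"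
  assume c: "c > 0" and d: "\<forall>n. d n \<ge> 1" and o: "(\<lambda>n. ln (real (d n))) \<in> o(\<lambda>n. ln (real n))"
  define T where "T = 2 powr c"
  have T: "T > 0" by (simp add: T_def)
  \<comment> \<open>The linear saving is \<open>d / (2 * T)\<close>. Half of it is given up to
    absorb the factorial, which leaves \<open>d / (4 * T)\<close> and explains
    \<open>c + 2\<close>.\<close>
  have T4: "2 powr (c + 2) = 4 * T" by (simp add: T_def powr_add)
  \<comment> \<open>The constant is chosen to yield
    \<open>d ^ d \<le> n powr (d / (4 * T))\<close>.\<close>
  have "\<forall>\<^sub>F n in sequentially. norm (ln (real (d n))) \<le> 1 / (4 * T) * norm (ln (real n))"
    using T by (intro landau_o.smallD[OF o]) simp
  then show "\<forall>\<^sub>F n in sequentially.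
           \<forall>(f :: (nat \<times> nat, 'a::field) mpoly) (\<Phi> :: (nat \<times> nat, 'a) formula).
             set_multilinear n (d n) f \<longrightarrow>
             formula_vars \<Phi> \<subseteq> partition_vars n (d n) \<longrightarrow>
             homogeneous_formula \<Phi> \<longrightarrow>
             formula_poly \<Phi> = f \<longrightarrow>
             real (formula_size \<Phi>) \<le> real n powr c \<longrightarrow>
             real (tensor_rank n (d n) f) \<le>
               real n ^ d n / real n powr (real (d n) / 2 powr (c + 2))"
    using eventually_ge_at_top[of 1]
  proof eventually_elim
    case (elim n)
    let ?N = "real n" and ?d = "d n"
    have N: "?N \<ge> 1" "n \<ge> 1" using elim by auto
    have d1: "?d \<ge> 1" using d by simp
    have small: "ln (real ?d) \<le> ln ?N / (4 * T)" using elim N d1 by simp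
    show ?case
    proof (intro allI impI)
      fix f :: "(nat \<times> nat, 'a) mpoly" and \<Phi> :: "(nat \<times> nat, 'a) formula"
      assume f: "set_multilinear n ?d f" and hom: "homogeneous_formula \<Phi>"
        and \<Phi>: "formula_poly \<Phi> = f" and size: "real (formula_size \<Phi>) \<le> ?N powr c"
      have rank: "real (tensor_rank n ?d f) \<le> b" if "rank_bound n {..<?d} b f" for b
        using that tensor_rank_le[OF d1] by (force simp: rank_bound_def)
      have "real (tensor_rank n ?d f) \<le> ?N powr (real ?d - real ?d / (4 * T))"
      \<comment> \<open>Up to the threshold the trivial bound already suffices: it saves 1, and
        \<open>d / (4 * T) \<le> 1 / 4\<close>.\<close>
      proof (cases "real ?d \<le> T")
        case True
        have "real (tensor_rank n ?d f) \<le> ?N ^ (?d - 1)"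
          using rank_bound_component[of "{..<?d}" n f] by (intro rank) (simp add: sm_component_set_multilinear[OF f])
        also have "\<dots> = ?N powr (real ?d - 1)" using N d1 by (simp add: powr_realpow[symmetric] of_nat_diff)
        also have "\<dots> \<le> ?N powr (real ?d - real ?d / (4 * T))"
          using True T N by (intro powr_mono) (auto simp: field_simps)
        finally show ?thesis .
      next
        case False
        have "real (tensor_rank n ?d f) \<le> real (formula_size \<Phi>) * weight n c ?d"
          using rank_bound_formula[OF N(2) less_imp_le[OF c] hom size, of "{..<?d}"]
          by (intro rank) (simp add: \<Phi> sm_component_set_multilinear[OF f])
        also have "\<dots> \<le> ?N powr c * weight n c ?d"
          by (rule mult_right_mono[OF size weight_nonneg])
        \<comment> \<open>Beyond the threshold the linear branch applies, and its constant
          \<open>c\<close> cancels the size factor \<open>n powr c\<close>.\<close>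
        also have "\<dots> = fact ?d * (?N powr c * ?N powr (real ?d - (c + real ?d / (2 * T))))"
          using False d1 by (simp add: weight_def saving_def T_def)
        also have "\<dots> = fact ?d * ?N powr (real ?d - real ?d / (2 * T))"
          by (simp flip: powr_add)
        also have "\<dots> \<le> ?N powr (real ?d / (4 * T)) * ?N powr (real ?d - real ?d / (2 * T))"
        proof (rule mult_right_mono)
          have "fact ?d \<le> (real ?d) ^ ?d" using fact_le_power[of ?d, where 'a = real] by simp
          also have "\<dots> = exp (real ?d * ln (real ?d))" using d1 by (simp add: exp_of_nat_mult)
          also have "\<dots> \<le> exp (real ?d * (ln ?N / (4 * T)))" unfolding exp_le_cancel_iff using small by (rule mult_left_mono) simp
          also have "\<dots> = ?N powr (real ?d / (4 * T))" using N by (simp add: powr_def)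
          finally show "fact ?d \<le> ?N powr (real ?d / (4 * T))" .
        qed simp
        also have "\<dots> = ?N powr (real ?d - real ?d / (4 * T))"
          using T by (simp add: powr_add[symmetric] field_simps)
        finally show ?thesis .
      qed
      also have "\<dots> = ?N ^ ?d / ?N powr (real ?d / 2 powr (c + 2))"
        using N by (simp add: T4 powr_diff powr_realpow)
      finally show "real (tensor_rank n ?d f) \<le> ?N ^ ?d / ?N powr (real ?d / 2 powr (c + 2))" .
    qed
  qed
qed

end
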